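(* Let $Q$ be a convex polygon with $n$ edges and diameter $D$, and let $p$ be a point moving around $Q$, with the inflated-hierarchy kinetic data structure (described in the context) maintaining a separating edge between $p$ and $Q$. After any event, if $d(p,Q)=\Omega(D/n)$, then $p$ must move at least $d(p,Q)/\beta$ before the next event, where $\beta=2(1+\sqrt2)\approx 4.8284$.
   Context: $d(p,Q)$ is the Euclidean distance from $p$ to $Q$. Boomerang hierarchy. Let $Q$ be a convex polygon, possibly with added zero-length edges at vertices, each with a prescribed outer normal lying between the normals of its neighboring edges. Start with a bounding rectangle $Q_0$ of $Q$. The (at most four) regions between $Q$ and $Q_0$ are the level-0 boomerangs; a boomerang is bounded by a concave chain of edges of $Q$ and by two further segments meeting at its apex. Recursively, a level-$i$ boomerang is split by the line through some (possibly zero-length) edge of its concave chain, perpendicular to that edge's outer normal, into a triangle containing the apex and two smaller level-$(i+1)$ boomerangs, until all edges of $Q$ have been introduced. The $i$-th envelope $Q_i$ is the union of $Q$ and all level-$i$ boomerangs; it is a convex polygon containing $Q$. Compass hierarchy. The boomerang hierarchy obtained by adding to $Q$ $O(n)$ zero-length edges whose outer normals form a regular recursive lattice of compass directions on the unit circle (E, N, W, S; then NE, NW, SW, SE; etc.), where in the top $\lceil\log_2 n\rceil$ levels each boomerang is subdivided, using these directions in order, into two smaller boomerangs and an isosceles triangle, and in the remaining levels, if any, each boomerang is split by the line through the median edge of its chain. Inflated hierarchy. For a convex polygon $R$ and $\varepsilon>0$, the offset polygon $R[\varepsilon]$ is the convex polygon obtained by moving each edge of $R$ (including zero-length ones) outwards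 by $\varepsilon$, vertices moving along their angle bisectors. Let $Q_0,Q_1,\dots$ be the compass hierarchy of $Q$, let $\varepsilon_i=\alpha D/2^i$ be the approximation error of $Q_i$ (level-$i$ boomerangs of the compass hierarchy have height, i.e. distance from apex to concave chain, $O(D/2^i)$; $\alpha$ is the corresponding constant), and let $Q'_i=Q_i[\varepsilon_i]$. The data structure. As $p$ moves, it maintains a separating edge $e$ of some uninflated envelope $Q_i$, i.e. an edge whose supporting line $\overleftrightarrow{e}$ has $p$ on one side and $Q$ on the other. An event occurs when $p$ crosses $\overleftrightarrow{e}$. To compute the new separating edge, one finds the index $j$ such that $p$ lies outside $Q'_j$ but inside $Q'_{j-1}$, and takes the edge of $Q_j$ parallel to the edge of $Q'_j$ that intersects $\overleftrightarrow{e}$. *)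

theory Defs
  imports "HOL-Analysis.Analysis"
begin

text \<open>
  The plane is \<^typ>\<open>complex\<close>.  An edge of a convex polygon \<open>R\<close> is named by the angle \<open>\<theta>\<close> of its
  outer normal \<open>cis \<theta>\<close>.  If \<open>cis \<theta>\<close> is normal to no side of \<open>R\<close>, then \<open>edge R \<theta>\<close> is a single vertex:
  the zero-length edge with outer normal \<open>cis \<theta>\<close>, which automatically lies between the normals of the
  sides adjacent to that vertex.
\<close>

definition convex_polygon :: "complex set \<Rightarrow> bool" where
  "convex_polygon Q \<longleftrightarrow> polytope Q \<and> aff_dim Q = 2"

definition num_edges :: "complex set \<Rightarrow> nat" where
  "num_edges Q = card {F. F edge_of Q}"

definition support_value :: "complex set \<Rightarrow> real \<Rightarrow> real" where
  "support_value R \<theta> = (SUP x\<in>R. x \<bullet> cis \<theta>)"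

definition support_line :: "complex set \<Rightarrow> real \<Rightarrow> complex set" where
  "support_line R \<theta> = {x. x \<bullet> cis \<theta> = support_value R \<theta>}"

definition edge :: "complex set \<Rightarrow> real \<Rightarrow> complex set" where
  "edge R \<theta> = R \<inter> support_line R \<theta>"

definition side_angles :: "complex set \<Rightarrow> real set" where
  "side_angles Q = {\<theta>\<in>{0..<2*pi}. edge Q \<theta> edge_of Q}"

text \<open>
  A boomerang is named by the normal angles \<open>(a, b)\<close>, \<open>a < b\<close>, of the two lines meeting at its apex.
  Its concave chain is the part of the boundary of \<open>Q\<close> from \<open>edge Q a\<close> to \<open>edge Q b\<close>; letting \<open>\<theta>\<close> range
  over the whole open interval adds only vertices, in particular the two ends of the chain.  The hull
  below is therefore the triangle spanned by the apex and the two ends.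
\<close>

definition apex :: "complex set \<Rightarrow> real \<times> real \<Rightarrow> complex" where
  "apex Q = (\<lambda>(a, b). THE x. x \<in> support_line Q a \<inter> support_line Q b)"

definition chain :: "complex set \<Rightarrow> real \<times> real \<Rightarrow> complex set" where
  "chain Q = (\<lambda>(a, b). \<Union>\<theta>\<in>{a<..<b}. edge Q \<theta>)"

definition boomerang :: "complex set \<Rightarrow> real \<times> real \<Rightarrow> complex set" where
  "boomerang Q B = closure (convex hull (insert (apex Q B) (chain Q B)) - Q)"

definition height :: "complex set \<Rightarrow> real \<times> real \<Rightarrow> real" where
  "height Q B = infdist (apex Q B) (chain Q B)"

definition compass_depth :: "complex set \<Rightarrow> nat" where
  "compass_depth Q = nat \<lceil>log 2 (real (num_edges Q))\<rceil>"

text \<open>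
  Splitting the boomerang \<open>(a, b)\<close> by the line through the edge with normal angle \<open>m\<close> leaves the
  boomerangs \<open>(a, m)\<close> and \<open>(m, b)\<close>.  Below the compass levels only genuine sides of \<open>Q\<close> remain to be
  introduced.  A chain without such sides leaves a degenerate boomerang, which is kept so that its
  two lines still count as edges of the later envelopes.
\<close>

fun subdivide :: "complex set \<Rightarrow> nat \<Rightarrow> real \<times> real \<Rightarrow> (real \<times> real) set" where
  "subdivide Q i (a, b) =
    (if i < compass_depth Q then {(a, (a + b) / 2), ((a + b) / 2, b)}
     else let ms = sorted_list_of_set {\<theta>\<in>side_angles Q. a < \<theta> \<and> \<theta> < b}
          in if ms = [] then {(a, b)}
             else let m = ms ! (length ms div 2) in {(a, m), (m, b)})"

primrec compass_boomerangs :: "complex set \<Rightarrow> nat \<Rightarrow> (real \<times> real) set" where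
  "compass_boomerangs Q 0 = {(0, pi/2), (pi/2, pi), (pi, 3*pi/2), (3*pi/2, 2*pi)}"
| "compass_boomerangs Q (Suc i) = (\<Union>B\<in>compass_boomerangs Q i. subdivide Q i B)"

definition envelope :: "complex set \<Rightarrow> nat \<Rightarrow> complex set" where
  "envelope Q i = Q \<union> (\<Union>B\<in>compass_boomerangs Q i. boomerang Q B)"

text \<open>The level-\<open>i\<close> boomerangs are cyclically consecutive, so every edge of the envelope, of zero
  length or not, is the first line of exactly one of them.\<close>

definition envelope_angles :: "complex set \<Rightarrow> nat \<Rightarrow> real set" where
  "envelope_angles Q i = fst ` compass_boomerangs Q i"

text \<open>
  \<open>offset N R \<epsilon>\<close> is the polygon \<open>R[\<epsilon>]\<close>, where \<open>N\<close> holds the normal angles of all edges of \<open>R\<close>,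
  including those of zero length.  Two lines that are both shifted by \<open>\<epsilon>\<close> meet on the bisector of
  the original ones.
\<close>

definition offset :: "real set \<Rightarrow> complex set \<Rightarrow> real \<Rightarrow> complex set" where
  "offset N R \<epsilon> = {x. \<forall>\<theta>\<in>N. x \<bullet> cis \<theta> \<le> support_value R \<theta> + \<epsilon>}"

text \<open>
  An admissible constant in the bound \<open>O(D/2^i)\<close> on the heights of level-\<open>i\<close> boomerangs; it must not
  depend on the polygon.  The bound concerns the levels reached by compass subdivision: a split
  at a median side need not halve the height.
\<close>

definition height_constant :: "real \<Rightarrow> bool" where
  "height_constant \<alpha> \<longleftrightarrow>
    (\<forall>Q i. convex_polygon Q \<longrightarrow> i \<le> compass_depth Q \<longrightarrow>
       (\<forall>B\<in>compass_boomerangs Q i. height Q B \<le> \<alpha> * diameter Q / 2 ^ i))"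

definition inflated :: "real \<Rightarrow> complex set \<Rightarrow> nat \<Rightarrow> complex set" where
  "inflated \<alpha> Q i = offset (envelope_angles Q i) (envelope Q i) (\<alpha> * diameter Q / 2 ^ i)"

definition separating :: "complex set \<Rightarrow> nat \<Rightarrow> real \<Rightarrow> complex \<Rightarrow> bool" where
  "separating Q i \<theta> p \<longleftrightarrow>
    \<theta> \<in> envelope_angles Q i \<and> support_value (envelope Q i) \<theta> < p \<bullet> cis \<theta>"

text \<open>
  The edge \<open>\<theta>\<close> of \<open>Q\<^sub>i\<close> is maintained from time \<open>s\<close> on, and the moving point \<open>p\<close> is on its line at the
  later time \<open>t\<close>, having stayed on the outer side until then.  Touching the line earlier is not
  excluded, nor is passing through it after \<open>t\<close> required, so that this covers both ways of treating
  a contact without a crossing.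
\<close>

definition next_event ::
  "complex set \<Rightarrow> (real \<Rightarrow> complex) \<Rightarrow> nat \<Rightarrow> real \<Rightarrow> real \<Rightarrow> real \<Rightarrow> bool" where
  "next_event Q p i \<theta> s t \<longleftrightarrow>
    s < t \<and> (\<forall>r\<in>{s..t}. support_value (envelope Q i) \<theta> \<le> p r \<bullet> cis \<theta>) \<and>
    p t \<in> support_line (envelope Q i) \<theta>"

text \<open>
  The new edge \<open>\<theta>'\<close> of \<open>Q\<^sub>j\<close> when a point at \<open>x\<close> hits the line of the edge \<open>\<theta>\<close> of \<open>Q\<^sub>i\<close>.  A point outside
  \<open>Q'\<^sub>0\<close> gets \<open>j = 0\<close>.  The line meets the boundary of \<open>Q'\<^sub>j\<close> twice; that the new edge is separating
  singles out the intersection on the side of \<open>x\<close>.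
\<close>

definition reselect ::
  "real \<Rightarrow> complex set \<Rightarrow> nat \<Rightarrow> real \<Rightarrow> complex \<Rightarrow> nat \<Rightarrow> real \<Rightarrow> bool" where
  "reselect \<alpha> Q i \<theta> x j \<theta>' \<longleftrightarrow>
    x \<notin> inflated \<alpha> Q j \<and> (j > 0 \<longrightarrow> x \<in> inflated \<alpha> Q (j - 1)) \<and>
    separating Q j \<theta>' x \<and>
    edge (inflated \<alpha> Q j) \<theta>' \<inter> support_line (envelope Q i) \<theta> \<noteq> {}"

text \<open>\<open>maintains \<alpha> Q p s i \<theta>\<close>: at time \<open>s\<close> the data structure starts to maintain the edge \<open>\<theta>\<close> of \<open>Q\<^sub>i\<close>.\<close>

inductive maintains ::
  "real \<Rightarrow> complex set \<Rightarrow> (real \<Rightarrow> complex) \<Rightarrow> real \<Rightarrow> nat \<Rightarrow> real \<Rightarrow> bool"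
  for \<alpha> Q p where
  start: "separating Q i \<theta> (p 0) \<Longrightarrow> maintains \<alpha> Q p 0 i \<theta>"
| event: "\<lbrakk>maintains \<alpha> Q p s i \<theta>; next_event Q p i \<theta> s t; reselect \<alpha> Q i \<theta> (p t) j \<theta>'\<rbrakk>
          \<Longrightarrow> maintains \<alpha> Q p t j \<theta>'"

end

theory Submission imports Defs begin

text \<open>
  At an event the point \<open>x\<close> lies on a line supporting \<open>Q\<close> at some \<open>z\<close>, and this line meets the new edge of
  \<open>Q'\<^sub>j\<close> at some \<open>y\<close>.  Since \<open>x \<notin> Q'\<^sub>j\<close> lies beyond the corresponding line of \<open>Q\<^sub>j\<close>, we get
  \<open>x = z + s (y - z)\<close> with \<open>s \<ge> 1\<close>, so the distance from \<open>x\<close> to that line is at least \<open>s \<epsilon>\<^sub>j\<close>.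
  If \<open>j > 0\<close>, then \<open>x \<in> Q'\<^sub>j\<^sub>-\<^sub>1\<close>.  The direction from the nearest point of \<open>Q\<close> to \<open>x\<close> is a nonnegative
  combination of the two normals of some boomerang, with coefficient sum at most \<open>sqrt 2\<close>, whence
  \<open>d(x, Q) \<le> (1 + sqrt 2) \<epsilon>\<^sub>j\<^sub>-\<^sub>1 = \<beta> \<epsilon>\<^sub>j\<close>; this uses the bound on the heights, which the hypothesis
  \<open>d(x, Q) \<ge> c D / n\<close> makes available.  If \<open>j = 0\<close>, there is no upper bound on \<open>d(x, Q)\<close>, but
  \<open>d(x, Q) \<le> s |y - z|\<close>, and an isosceles right triangle shows \<open>\<alpha> \<ge> 1/2\<close>, so that
  \<open>|y - z| \<le> sqrt 2 (D + \<epsilon>\<^sub>0) \<le> 3 sqrt 2 \<epsilon>\<^sub>0\<close>, which is less than \<open>\<beta> \<epsilon>\<^sub>0\<close>.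
\<close>

section \<open>Support support_T and apexes\<close>

lemma inner_cis: "x \<bullet> cis \<theta> = Re x * cos \<theta> + Im x * sin \<theta>"
  by (simp add: inner_complex_def)

text \<open>Cramer's rule for \<open>cis \<theta>\<close> in the basis \<open>cis a\<close>,
  \<open>cis b\<close>. If \<open>b - a < pi\<close> and \<open>\<theta>\<close> lies between
  \<open>a\<close> and \<open>b\<close>, both coefficients are nonnegative; the estimates at a
  boomerang rest on these signs.\<close>

lemma inner_sin_diff_cis:
  "sin (b - a) * (x \<bullet> cis \<theta>) = sin (b - \<theta>) * (x \<bullet> cis a) + sin (\<theta> - a) * (x \<bullet> cis b)"
  by (simp add: inner_cis sin_diff algebra_simps)

lemma support_value_eqI:
  assumes "w \<in> R" "w \<bullet> cis \<theta> = h" "\<And>x. x \<in> R \<Longrightarrow> x \<bullet> cis \<theta> \<le> h"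
  shows "support_value R \<theta> = h"
  unfolding support_value_def
proof (rule cSup_eq_maximum)
  show "h \<in> (\<lambda>x. x \<bullet> cis \<theta>) ` R" using assms(1,2) by blast
qed (use assms(3) in blast)

lemma support_value_attained:
  assumes "compact Q" "Q \<noteq> {}"
  obtains w where "w \<in> Q" "support_value Q \<theta> = w \<bullet> cis \<theta>"
proof -
  have "continuous_on Q (\<lambda>x. x \<bullet> cis \<theta>)" by (intro continuous_intros)
  then obtain w where w: "w \<in> Q" "\<And>x. x \<in> Q \<Longrightarrow> x \<bullet> cis \<theta> \<le> w \<bullet> cis \<theta>"
    using continuous_attains_sup[OF assms] by blast
  from w(1) refl w(2) have "support_value Q \<theta> = w \<bullet> cis \<theta>" by (rule support_value_eqI)
  with w(1) show thesis by (rule that)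
qed

lemma inner_le_support_value:
  assumes "compact Q" "x \<in> Q"
  shows "x \<bullet> cis \<theta> \<le> support_value Q \<theta>"
proof -
  have "compact ((\<lambda>x. x \<bullet> cis \<theta>) ` Q)"
    using assms(1) by (intro compact_continuous_image continuous_intros)
  then have "bdd_above ((\<lambda>x. x \<bullet> cis \<theta>) ` Q)"
    by (intro bounded_imp_bdd_above compact_imp_bounded)
  then show ?thesis
    unfolding support_value_def using assms(2) by (intro cSUP_upper)
qed

lemma edge_nonempty:
  assumes "compact Q" "Q \<noteq> {}"
  shows "edge Q \<theta> \<noteq> {}"
proof -
  obtain w where "w \<in> Q" "support_value Q \<theta> = w \<bullet> cis \<theta>"
    using assms by (rule support_value_attained[of Q \<theta>])
  then have "w \<in> edge Q \<theta>" by (simp add: edge_def support_line_def)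
  then show ?thesis by blast
qed

text \<open>The two normals are linearly independent, so their lines meet in exactly one point and
  the description in \<open>apex\<close> denotes it.\<close>

lemma apex_on_lines:
  assumes "0 < b - a" "b - a < pi"
  shows "apex Q (a, b) \<bullet> cis a = support_value Q a" "apex Q (a, b) \<bullet> cis b = support_value Q b"
proof -
  define \<sigma> where "\<sigma> = sin (b - a)"
  have \<sigma>: "\<sigma> \<noteq> 0" using sin_gt_zero[OF assms] by (simp add: \<sigma>_def)
  define u v where "u = support_value Q a" and "v = support_value Q b"
  define x where "x = Complex ((u * sin b - v * sin a) / \<sigma>) ((v * cos a - u * cos b) / \<sigma>)"
  have "x \<bullet> cis \<theta> = ((u * sin b - v * sin a) * cos \<theta> + (v * cos a - u * cos b) * sin \<theta>) / \<sigma>" for \<theta>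
    by (simp add: x_def inner_cis add_divide_distrib)
  moreover have "(u * sin b - v * sin a) * cos a + (v * cos a - u * cos b) * sin a = u * \<sigma>"
    "(u * sin b - v * sin a) * cos b + (v * cos a - u * cos b) * sin b = v * \<sigma>"
    by (simp_all add: \<sigma>_def sin_diff algebra_simps)
  ultimately have x: "x \<in> support_line Q a \<inter> support_line Q b"
    using \<sigma> by (simp add: support_line_def u_def v_def)
  have unique: "y = x" if "y \<in> support_line Q a \<inter> support_line Q b" for y
  proof -
    have ip: "y \<bullet> cis a = x \<bullet> cis a" "y \<bullet> cis b = x \<bullet> cis b"
      using that x by (auto simp: support_line_def)
    have "\<sigma> * (y \<bullet> cis \<theta>) = \<sigma> * (x \<bullet> cis \<theta>)" for \<theta>
      using inner_sin_diff_cis[of b a y \<theta>] inner_sin_diff_cis[of b a x \<theta>] ip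
      by (simp add: \<sigma>_def)
    then have "y \<bullet> cis \<theta> = x \<bullet> cis \<theta>" for \<theta>
      using \<sigma> by simp
    from this[of 0] this[of "pi/2"] show ?thesis
      by (simp add: inner_cis complex_eq_iff)
  qed
  have "apex Q (a, b) = x"
    unfolding apex_def prod.case by (rule the_equality, rule x, rule unique)
  with x show "apex Q (a, b) \<bullet> cis a = support_value Q a" "apex Q (a, b) \<bullet> cis b = support_value Q b"
    by (auto simp: support_line_def)
qed

text \<open>Outside the cone of the two normals one coefficient of \<open>cis \<theta>\<close> is
  nonpositive. A point of \<open>Q\<close> touching the line of the other normal agrees with the
  apex there and can only fall short along the normal that counts negatively, so it reaches at least
  as far as the apex.\<close>

lemma apex_inner_le_support_value:
  assumes Q: "compact Q" "Q \<noteq> {}"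
    and ab: "0 < b - a" "b - a < pi"
    and outside: "sin (b - \<theta>) \<le> 0 \<or> sin (\<theta> - a) \<le> 0"
  shows "apex Q (a, b) \<bullet> cis \<theta> \<le> support_value Q \<theta>"
proof -
  define A \<sigma> p q where "A = apex Q (a, b)" and "\<sigma> = sin (b - a)"
    and "p = sin (b - \<theta>)" and "q = sin (\<theta> - a)"
  note A = apex_on_lines[OF ab, of Q, folded A_def]
  have \<sigma>: "\<sigma> > 0" using sin_gt_zero[OF ab] by (simp add: \<sigma>_def)
  have id: "\<sigma> * (x \<bullet> cis \<theta>) = p * (x \<bullet> cis a) + q * (x \<bullet> cis b)" for x
    unfolding \<sigma>_def p_def q_def by (rule inner_sin_diff_cis)
  have "\<exists>w\<in>Q. p * support_value Q a + q * support_value Q b \<le> p * (w \<bullet> cis a) + q * (w \<bullet> cis b)"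
  proof -
    obtain w where w: "w \<in> Q" "support_value Q a = w \<bullet> cis a"
      using support_value_attained[OF Q, of a] by metis
    obtain w' where w': "w' \<in> Q" "support_value Q b = w' \<bullet> cis b"
      using support_value_attained[OF Q, of b] by metis
    have wb: "w \<bullet> cis b \<le> support_value Q b" using inner_le_support_value[OF Q(1) w(1)] .
    have w'a: "w' \<bullet> cis a \<le> support_value Q a" using inner_le_support_value[OF Q(1) w'(1)] .
    show ?thesis
    proof (cases "q \<le> 0")
      case True
      then show ?thesis using w wb by (intro bexI[of _ w]) (auto intro: mult_left_mono_neg)
    next
      case False
      then have "p \<le> 0" using outside by (simp add: p_def q_def)
      then show ?thesis using w' w'a by (intro bexI[of _ w']) (auto intro: mult_left_mono_neg)
    qed
  qed
  then obtain w where "w \<in> Q" "\<sigma> * (A \<bullet> cis \<theta>) \<le> \<sigma> * (w \<bullet> cis \<theta>)"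
    unfolding id A by blast
  then have "A \<bullet> cis \<theta> \<le> w \<bullet> cis \<theta>" using \<sigma> by simp
  then show ?thesis
    using inner_le_support_value[OF Q(1) \<open>w \<in> Q\<close>, of \<theta>] by (simp add: A_def)
qed

section \<open>The intervals of normal angles\<close>

text \<open>Hides whether a split is a compass or a median one: later arguments use only that the
  splitting angle lies inside the interval.\<close>

lemma subdivide_cases:
  obtains "subdivide Q i (a, b) = {(a, b)}"
  | m where "a < b \<Longrightarrow> a < m" "a < b \<Longrightarrow> m < b" "subdivide Q i (a, b) = {(a, m), (m, b)}"
proof (cases "i < compass_depth Q")
  case True
  then show ?thesis by (intro that(2)[of "(a + b) / 2"]) auto
next
  case False
  define S where "S = {\<theta>\<in>side_angles Q. a < \<theta> \<and> \<theta> < b}"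
  define ms where "ms = sorted_list_of_set S"
  have eq: "subdivide Q i (a, b) = (if ms = [] then {(a, b)}
      else {(a, ms ! (length ms div 2)), (ms ! (length ms div 2), b)})"
    using False by (simp add: ms_def S_def Let_def)
  show ?thesis
  proof (cases "ms = []")
    case True
    with eq that(1) show ?thesis by simp
  next
    case nonempty: False
    then have "ms ! (length ms div 2) \<in> set ms" by (intro nth_mem) simp
    \<comment> \<open>\<open>sorted_list_of_set\<close> gives the empty list on an infinite set, so
      a nonempty \<open>ms\<close> already yields finiteness.\<close>
    moreover have "finite S" using nonempty sorted_list_of_set.fold_insort_key.infinite ms_def by blast
    ultimately have "ms ! (length ms div 2) \<in> S" by (simp add: ms_def)
    then show ?thesis
      using that(2)[of "ms ! (length ms div 2)"] nonempty eq by (simp add: S_def)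
  qed
qed

lemma compass_boomerangs_range:
  assumes "(a, b) \<in> compass_boomerangs Q i"
  shows "0 \<le> a" "a < b" "b \<le> 2 * pi" "b - a \<le> pi / 2"
proof -
  have "0 \<le> a \<and> a < b \<and> b \<le> 2 * pi \<and> b - a \<le> pi / 2" using assms
  proof (induction i arbitrary: a b)
    case 0
    then show ?case by (auto, (use pi_gt_zero in linarith)+)
  next
    case (Suc i)
    then obtain a0 b0 where B: "(a0, b0) \<in> compass_boomerangs Q i" "(a, b) \<in> subdivide Q i (a0, b0)"
      by (auto simp del: subdivide.simps)
    show ?case
      by (rule subdivide_cases[of Q i a0 b0]) (use Suc.IH[OF B(1)] B(2) in \<open>auto simp del: subdivide.simps\<close>)
  qed
  then show "0 \<le> a" "a < b" "b \<le> 2 * pi" "b - a \<le> pi / 2" by auto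
qed

text \<open>Siblings are separated by their splitting angle, other intervals by their parents. Hence
  no envelope angle falls strictly inside an interval of its level.\<close>

lemma compass_boomerangs_disjoint:
  assumes "(a, b) \<in> compass_boomerangs Q i" "(a', b') \<in> compass_boomerangs Q i"
  shows "(a, b) = (a', b') \<or> b \<le> a' \<or> b' \<le> a"
  using assms
proof (induction i arbitrary: a b a' b')
  case 0
  then show ?case by auto
next
  case (Suc i)
  obtain a0 b0 where B: "(a0, b0) \<in> compass_boomerangs Q i" "(a, b) \<in> subdivide Q i (a0, b0)"
    using Suc.prems(1) by (auto simp del: subdivide.simps)
  obtain a1 b1 where B': "(a1, b1) \<in> compass_boomerangs Q i" "(a', b') \<in> subdivide Q i (a1, b1)"
    using Suc.prems(2) by (auto simp del: subdivide.simps)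
  have nested: "c \<le> a \<and> b \<le> d"
    if "(c, d) \<in> compass_boomerangs Q i" "(a, b) \<in> subdivide Q i (c, d)" for a b c d
    by (rule subdivide_cases[of Q i c d])
      (use that(2) compass_boomerangs_range[OF that(1)] in \<open>auto simp del: subdivide.simps\<close>)
  show ?case
  proof (cases "(a0, b0) = (a1, b1)")
    case True
    show ?thesis
      by (rule subdivide_cases[of Q i a0 b0]) (use B(2) B'(2) True in \<open>auto simp del: subdivide.simps\<close>)
  next
    case False
    then have "b0 \<le> a1 \<or> b1 \<le> a0" using Suc.IH[OF B(1) B'(1)] by blast
    then show ?thesis using nested[OF B] nested[OF B'] by linarith
  qed
qed

lemma compass_boomerangs_cover:
  assumes "0 \<le> \<phi>" "\<phi> < 2 * pi"
  shows "\<exists>a b. (a, b) \<in> compass_boomerangs Q i \<and> a \<le> \<phi> \<and> \<phi> < b"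
proof (induction i)
  case 0
  have "0 \<le> \<phi> \<and> \<phi> < pi / 2 \<or> pi / 2 \<le> \<phi> \<and> \<phi> < pi \<or> pi \<le> \<phi> \<and> \<phi> < 3 * pi / 2
      \<or> 3 * pi / 2 \<le> \<phi> \<and> \<phi> < 2 * pi"
    using assms by linarith
  then show ?case unfolding compass_boomerangs.simps by blast
next
  case (Suc i)
  then obtain a b where B: "(a, b) \<in> compass_boomerangs Q i" "a \<le> \<phi>" "\<phi> < b" by blast
  have "\<exists>a' b'. (a', b') \<in> subdivide Q i (a, b) \<and> a' \<le> \<phi> \<and> \<phi> < b'"
  proof (rule subdivide_cases[of Q i a b])
    assume "subdivide Q i (a, b) = {(a, b)}"
    with B show ?thesis by auto
  next
    fix m assume m: "subdivide Q i (a, b) = {(a, m), (m, b)}"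
    have "\<phi> < m \<or> m \<le> \<phi>" by linarith
    with B(2,3) show ?thesis unfolding m by blast
  qed
  with B(1) show ?case unfolding compass_boomerangs.simps by blast
qed

lemma envelope_angles_mono:
  assumes "i \<le> j"
  shows "envelope_angles Q i \<subseteq> envelope_angles Q j"
proof (rule lift_Suc_mono_le[OF _ assms])
  fix i
  have "a \<in> fst ` subdivide Q i (a, b)" for a b
    by (rule subdivide_cases[of Q i a b]) (auto simp del: subdivide.simps)
  then show "envelope_angles Q i \<subseteq> envelope_angles Q (Suc i)"
    by (force simp: envelope_angles_def simp del: subdivide.simps)
qed

section \<open>Envelopes and their offsets\<close>

text \<open>Since \<open>\<theta>\<close> is not inside the interval of any boomerang, every apex
  stays behind the line of \<open>\<theta>\<close>, and the closed convex half-plane takes in the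
  whole boomerang.\<close>

lemma envelope_inner_le:
  assumes Q: "compact Q" "Q \<noteq> {}" and \<theta>: "\<theta> \<in> envelope_angles Q i" and x: "x \<in> envelope Q i"
  shows "x \<bullet> cis \<theta> \<le> support_value Q \<theta>"
proof (cases "x \<in> Q")
  case True
  then show ?thesis using inner_le_support_value[OF Q(1)] by blast
next
  case False
  then obtain a b where B: "(a, b) \<in> compass_boomerangs Q i" and xB: "x \<in> boomerang Q (a, b)"
    using x by (auto simp: envelope_def)
  obtain b' where B': "(\<theta>, b') \<in> compass_boomerangs Q i"
    using \<theta> by (auto simp: envelope_angles_def)
  note r = compass_boomerangs_range[OF B] and r' = compass_boomerangs_range[OF B']
  have "\<theta> \<le> a \<or> b \<le> \<theta>"
    using compass_boomerangs_disjoint[OF B B'] r r' by auto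
  \<comment> \<open>Angles are not reduced modulo \<open>2 * pi\<close>. A gap of more than
    \<open>pi\<close> just makes the other sine the nonpositive one.\<close>
  then have "sin (b - \<theta>) \<le> 0 \<or> sin (\<theta> - a) \<le> 0"
  proof
    assume "\<theta> \<le> a"
    show ?thesis
    proof (cases "a - \<theta> \<le> pi")
      case True
      then have "sin (a - \<theta>) \<ge> 0" using \<open>\<theta> \<le> a\<close> by (intro sin_ge_zero) auto
      then show ?thesis using sin_minus[of "a - \<theta>"] by simp
    next
      case False
      then have "sin (b - \<theta> - pi) \<ge> 0" using r r' by (intro sin_ge_zero) auto
      then show ?thesis by (simp add: sin_diff)
    qed
  next
    assume "b \<le> \<theta>"
    show ?thesis
    proof (cases "\<theta> - b \<le> pi")
      case True
      then have "sin (\<theta> - b) \<ge> 0" using \<open>b \<le> \<theta>\<close> by (intro sin_ge_zero) auto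
      then show ?thesis using sin_minus[of "\<theta> - b"] by simp
    next
      case False
      then have "sin (\<theta> - a - pi) \<ge> 0" using r r' by (intro sin_ge_zero) auto
      then show ?thesis by (simp add: sin_diff)
    qed
  qed
  moreover have "b - a < pi" "0 < b - a" using r pi_gt_zero by linarith+
  ultimately have A: "apex Q (a, b) \<bullet> cis \<theta> \<le> support_value Q \<theta>"
    using apex_inner_le_support_value[OF Q] by blast
  define H where "H = {x. cis \<theta> \<bullet> x \<le> support_value Q \<theta>}"
  have "chain Q (a, b) \<subseteq> Q" by (auto simp: chain_def edge_def)
  then have "insert (apex Q (a, b)) (chain Q (a, b)) \<subseteq> H"
    using A inner_le_support_value[OF Q(1)] by (auto simp: H_def inner_commute)
  then have "convex hull (insert (apex Q (a, b)) (chain Q (a, b))) \<subseteq> H"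
    by (rule hull_minimal) (simp add: H_def convex_halfspace_le)
  then have "boomerang Q (a, b) \<subseteq> H"
    unfolding boomerang_def by (intro closure_minimal) (auto simp: H_def closed_halfspace_le)
  with xB show ?thesis by (auto simp: H_def inner_commute)
qed

text \<open>From here on the inflated polygons are described by support values of \<open>Q\<close>
  alone.\<close>

lemma support_value_envelope:
  assumes Q: "compact Q" "Q \<noteq> {}" and \<theta>: "\<theta> \<in> envelope_angles Q i"
  shows "support_value (envelope Q i) \<theta> = support_value Q \<theta>"
proof -
  obtain w where w: "w \<in> Q" "support_value Q \<theta> = w \<bullet> cis \<theta>"
    using support_value_attained[OF Q, of \<theta>] by metis
  have "w \<in> envelope Q i" using w(1) by (simp add: envelope_def)
  then show ?thesis using w(2)[symmetric] envelope_inner_le[OF Q \<theta>] by (rule support_value_eqI)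
qed

lemma inflated_iff:
  assumes "compact Q" "Q \<noteq> {}"
  shows "x \<in> inflated \<alpha> Q i \<longleftrightarrow>
    (\<forall>\<theta>\<in>envelope_angles Q i. x \<bullet> cis \<theta> \<le> support_value Q \<theta> + \<alpha> * diameter Q / 2 ^ i)"
  using support_value_envelope[OF assms] by (simp add: inflated_def offset_def)

lemma subset_inflated:
  assumes "compact Q" "0 \<le> \<alpha> * diameter Q"
  shows "Q \<subseteq> inflated \<alpha> Q i"
proof
  fix x assume "x \<in> Q"
  then have "Q \<noteq> {}" by blast
  have "0 \<le> \<alpha> * diameter Q / 2 ^ i" using assms by simp
  then show "x \<in> inflated \<alpha> Q i"
    using inflated_iff[OF assms(1) \<open>Q \<noteq> {}\<close>] inner_le_support_value[OF assms(1) \<open>x \<in> Q\<close>]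
    by (metis add_increasing2)
qed

lemma convex_inflated: "convex (inflated \<alpha> Q i)"
proof -
  have "inflated \<alpha> Q i = (\<Inter>\<theta>\<in>envelope_angles Q i.
      {x. cis \<theta> \<bullet> x \<le> support_value (envelope Q i) \<theta> + \<alpha> * diameter Q / 2 ^ i})"
    by (auto simp: inflated_def offset_def inner_commute)
  then show ?thesis by (simp add: convex_INT convex_halfspace_le)
qed

text \<open>A deeper level has more lines and a smaller shift. This carries points from levels
  beyond the compass ones back to level \<open>compass_depth Q\<close>, where heights are
  bounded.\<close>

lemma inflated_antimono:
  assumes Q: "compact Q" "Q \<noteq> {}" and "0 \<le> \<alpha> * diameter Q" "i \<le> j"
  shows "inflated \<alpha> Q j \<subseteq> inflated \<alpha> Q i"
proof
  fix x assume x: "x \<in> inflated \<alpha> Q j"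
  have "\<alpha> * diameter Q / 2 ^ j \<le> \<alpha> * diameter Q / 2 ^ i"
    using assms by (intro divide_left_mono power_increasing) auto
  then show "x \<in> inflated \<alpha> Q i"
    using x envelope_angles_mono[OF \<open>i \<le> j\<close>, of Q] unfolding inflated_iff[OF Q] by fastforce
qed

text \<open>A contact point moved by the shift along its normal respects all other shifted lines
  because \<open>cos\<close> is at most 1. So every shifted line touches the offset polygon, also
  for zero-length edges.\<close>

lemma support_value_inflated:
  assumes Q: "compact Q" "Q \<noteq> {}" and "0 \<le> \<alpha> * diameter Q" and \<theta>: "\<theta> \<in> envelope_angles Q i"
  shows "support_value (inflated \<alpha> Q i) \<theta> = support_value Q \<theta> + \<alpha> * diameter Q / 2 ^ i"
proof -
  define \<epsilon> where "\<epsilon> = \<alpha> * diameter Q / 2 ^ i"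
  have \<epsilon>: "\<epsilon> \<ge> 0" using assms by (simp add: \<epsilon>_def)
  obtain w where w: "w \<in> Q" "support_value Q \<theta> = w \<bullet> cis \<theta>"
    using support_value_attained[OF Q, of \<theta>] by metis
  define v where "v = w + of_real \<epsilon> * cis \<theta>"
  have v: "v \<bullet> cis \<phi> = w \<bullet> cis \<phi> + \<epsilon> * cos (\<theta> - \<phi>)" for \<phi>
    by (simp add: v_def inner_cis cos_diff algebra_simps)
  have "v \<bullet> cis \<phi> \<le> support_value Q \<phi> + \<epsilon>" for \<phi>
    using v[of \<phi>] inner_le_support_value[OF Q(1) w(1), of \<phi>] mult_left_mono[OF cos_le_one \<epsilon>, of "\<theta> - \<phi>"]
    by simp
  then have "v \<in> inflated \<alpha> Q i" by (simp add: inflated_iff[OF Q] \<epsilon>_def)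
  moreover have "v \<bullet> cis \<theta> = support_value Q \<theta> + \<epsilon>" using v[of \<theta>] w by simp
  moreover have "y \<bullet> cis \<theta> \<le> support_value Q \<theta> + \<epsilon>" if "y \<in> inflated \<alpha> Q i" for y
    using that \<theta> by (simp add: inflated_iff[OF Q] \<epsilon>_def)
  ultimately show ?thesis unfolding \<epsilon>_def by (rule support_value_eqI)
qed

section \<open>Distance from \<open>Q\<close> within an inflated envelope\<close>

lemma apex_inner_le_height:
  assumes Q: "compact Q" "Q \<noteq> {}" and "a < b"
  shows "apex Q (a, b) \<bullet> cis \<phi> \<le> support_value Q \<phi> + height Q (a, b)"
proof -
  define A where "A = apex Q (a, b)"
  have nonempty: "chain Q (a, b) \<noteq> {}"
    using edge_nonempty[OF Q, of "(a + b) / 2"] \<open>a < b\<close> unfolding chain_def by fastforce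
  have "A \<bullet> cis \<phi> - support_value Q \<phi> \<le> dist A w" if "w \<in> chain Q (a, b)" for w
  proof -
    have "w \<in> Q" using that by (auto simp: chain_def edge_def)
    then have "w \<bullet> cis \<phi> \<le> support_value Q \<phi>" by (rule inner_le_support_value[OF Q(1)])
    moreover have "(A - w) \<bullet> cis \<phi> \<le> dist A w"
      using norm_cauchy_schwarz[of "A - w" "cis \<phi>"] by (simp add: dist_norm)
    ultimately show ?thesis by (simp add: inner_diff_left)
  qed
  \<comment> \<open>\<open>infdist\<close> to the empty set is 0, hence the need for a nonempty
    chain.\<close>
  then have "A \<bullet> cis \<phi> - support_value Q \<phi> \<le> infdist A (chain Q (a, b))"
    using nonempty by (auto simp: infdist_def intro: cINF_greatest)
  then show ?thesis by (simp add: height_def A_def)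
qed

text \<open>For \<open>a < b\<close>, the left side divided by \<open>sin (b - a)\<close> is the
  coefficient sum of \<open>cis \<phi>\<close> in \<open>inner_sin_diff_cis\<close>. The bound is
  attained on the bisector of a right angle.\<close>

lemma sin_add_sin_le:
  fixes a b \<phi> :: real
  assumes "a \<le> b" "b - a \<le> pi / 2"
  shows "sin (b - \<phi>) + sin (\<phi> - a) \<le> sqrt 2 * sin (b - a)"
proof -
  define u where "u = (b - a) / 2"
  have u: "0 \<le> u" "u \<le> pi / 4" using assms by (auto simp: u_def)
  have s: "sin u \<ge> 0" using u pi_gt_zero by (intro sin_ge_zero) auto
  have "cos (pi / 4) \<le> cos u" using u pi_gt_zero by (intro cos_monotone_0_pi_le) auto
  then have "sqrt 2 * (sqrt 2 / 2) \<le> sqrt 2 * cos u" unfolding cos_45 by (rule mult_left_mono) simp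
  moreover have "sqrt 2 * (sqrt 2 / 2) = 1" by simp
  ultimately have c: "1 \<le> sqrt 2 * cos u" by linarith
  have "sin (b - \<phi>) + sin (\<phi> - a) = 2 * sin u * cos ((a + b) / 2 - \<phi>)"
    unfolding sin_plus_sin u_def by (simp add: field_simps)
  also have "\<dots> \<le> 2 * sin u * (sqrt 2 * cos u)"
    using s by (intro mult_left_mono order_trans[OF cos_le_one c]) auto
  also have "\<dots> = sqrt 2 * sin (2 * u)" by (simp add: sin_double)
  also have "2 * u = b - a" by (simp add: u_def)
  finally show ?thesis .
qed

text \<open>In the direction from the nearest point to \<open>x\<close> the distance splits in two:
  \<open>x\<close> exceeds an apex by at most \<open>sqrt 2\<close> shifts, and the apex exceeds
  \<open>Q\<close> by at most its height, hence by one shift.\<close>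

lemma infdist_inflated_le:
  assumes height: "height_constant \<alpha>" and poly: "convex_polygon Q"
    and i: "i \<le> compass_depth Q" and nonneg: "0 \<le> \<alpha> * diameter Q"
    and x: "x \<in> inflated \<alpha> Q i"
  shows "infdist x Q \<le> (1 + sqrt 2) * (\<alpha> * diameter Q / 2 ^ i)"
proof (cases "x \<in> Q")
  case True
  have "0 \<le> (1 + sqrt 2) * (\<alpha> * diameter Q / 2 ^ i)"
    by (intro mult_nonneg_nonneg[of "1 + sqrt 2"] divide_nonneg_nonneg nonneg) auto
  with True show ?thesis by simp
next
  case False
  define \<epsilon> where "\<epsilon> = \<alpha> * diameter Q / 2 ^ i"
  have \<epsilon>: "\<epsilon> \<ge> 0" using nonneg by (simp add: \<epsilon>_def)
  have Q: "compact Q" "Q \<noteq> {}" "convex Q"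
    using poly by (auto simp: convex_polygon_def polytope_imp_compact polytope_imp_convex)
  define q where "q = closest_point Q x"
  have q: "q \<in> Q" unfolding q_def using Q closest_point_in_set compact_imp_closed by blast
  \<comment> \<open>\<open>Arg2pi\<close> takes values in \<open>[0, 2 * pi)\<close>, the range
    covered by the intervals of each level.\<close>
  define \<phi> where "\<phi> = Arg2pi (x - q)"
  have \<phi>: "0 \<le> \<phi>" "\<phi> < 2 * pi" by (auto simp: \<phi>_def Arg2pi)
  have direction: "x - q = dist x q *\<^sub>R cis \<phi>"
    using Arg2pi_eq[of "x - q"] by (simp add: \<phi>_def cis_conv_exp dist_norm scaleR_conv_of_real)
  have pos: "dist x q > 0" using q False by auto
  have normal: "q \<bullet> cis \<phi> = support_value Q \<phi>"
  proof -
    obtain w where w: "w \<in> Q" "support_value Q \<phi> = w \<bullet> cis \<phi>"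
      using support_value_attained[OF Q(1,2), of \<phi>] by metis
    \<comment> \<open>By the obtuse angle property of the nearest point, the line through
      \<open>q\<close> orthogonal to \<open>x - q\<close> supports \<open>Q\<close>.\<close>
    have "(x - q) \<bullet> (w - q) \<le> 0"
      unfolding q_def using Q w by (intro closest_point_dot compact_imp_closed)
    then have "dist x q * ((w - q) \<bullet> cis \<phi>) \<le> 0"
      unfolding direction by (simp add: inner_commute)
    then have "(w - q) \<bullet> cis \<phi> \<le> 0" using pos by (simp add: mult_le_0_iff)
    then show ?thesis
      using inner_le_support_value[OF Q(1) q, of \<phi>] w by (simp add: inner_diff_left)
  qed
  have dist: "dist x q = x \<bullet> cis \<phi> - support_value Q \<phi>"
  proof -
    have "(x - q) \<bullet> cis \<phi> = dist x q * (cis \<phi> \<bullet> cis \<phi>)"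
      unfolding direction by simp
    then show ?thesis using normal by (simp add: inner_diff_left dot_square_norm)
  qed
  obtain a b where B: "(a, b) \<in> compass_boomerangs Q i" and ab: "a \<le> \<phi>" "\<phi> < b"
    using compass_boomerangs_cover[OF \<phi>] by blast
  note r = compass_boomerangs_range[OF B]
  have ba: "0 < b - a" "b - a < pi" using r pi_gt_zero by linarith+
  define A \<sigma> where "A = apex Q (a, b)" and "\<sigma> = sin (b - a)"
  note A = apex_on_lines[OF ba, of Q, folded A_def]
  have \<sigma>: "\<sigma> > 0" using sin_gt_zero[OF ba] by (simp add: \<sigma>_def)
  have coeff: "sin (b - \<phi>) \<ge> 0" "sin (\<phi> - a) \<ge> 0" using ab ba by (auto intro!: sin_ge_zero)
  have xa: "x \<bullet> cis a \<le> A \<bullet> cis a + \<epsilon>"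
    using x B unfolding inflated_iff[OF Q(1,2)] A \<epsilon>_def envelope_angles_def by force
  \<comment> \<open>The angle \<open>b\<close> is an envelope angle as well, but of the next boomerang, modulo \<open>2 * pi\<close>.\<close>
  have xb: "x \<bullet> cis b \<le> A \<bullet> cis b + \<epsilon>"
  proof (cases "b = 2 * pi")
    case True
    obtain a' b' where B': "(a', b') \<in> compass_boomerangs Q i" "a' \<le> 0"
      using compass_boomerangs_cover[of 0 Q i] pi_gt_zero by auto
    have "a' = 0" using compass_boomerangs_range[OF B'(1)] B'(2) by linarith
    then have "x \<bullet> cis 0 \<le> support_value Q 0 + \<epsilon>"
      using x B' unfolding inflated_iff[OF Q(1,2)] \<epsilon>_def envelope_angles_def by force
    moreover have "cis b = cis 0" using True by simp
    ultimately show ?thesis unfolding A by (simp add: support_value_def)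
  next
    case False
    then have "0 \<le> b" "b < 2 * pi" using r by auto
    then obtain a' b' where B': "(a', b') \<in> compass_boomerangs Q i" "a' \<le> b" "b < b'"
      using compass_boomerangs_cover by blast
    have "a' = b" using compass_boomerangs_disjoint[OF B B'(1)] B'(2,3) r by auto
    then show ?thesis
      using x B' unfolding inflated_iff[OF Q(1,2)] A \<epsilon>_def envelope_angles_def by force
  qed
  have "\<sigma> * (x \<bullet> cis \<phi>) \<le> \<sigma> * (A \<bullet> cis \<phi>) + \<epsilon> * (sin (b - \<phi>) + sin (\<phi> - a))"
    using mult_left_mono[OF xa coeff(1)] mult_left_mono[OF xb coeff(2)]
      inner_sin_diff_cis[of b a x \<phi>] inner_sin_diff_cis[of b a A \<phi>]
    by (simp add: \<sigma>_def ring_distribs mult.commute)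
  also have "\<dots> \<le> \<sigma> * (A \<bullet> cis \<phi>) + \<epsilon> * (sqrt 2 * \<sigma>)"
    using sin_add_sin_le[of a b \<phi>] r \<epsilon> unfolding \<sigma>_def by (intro add_left_mono mult_left_mono) auto
  also have "\<dots> = \<sigma> * (A \<bullet> cis \<phi> + sqrt 2 * \<epsilon>)" by (simp add: algebra_simps)
  finally have "x \<bullet> cis \<phi> \<le> A \<bullet> cis \<phi> + sqrt 2 * \<epsilon>" using \<sigma> by simp
  also have "A \<bullet> cis \<phi> \<le> support_value Q \<phi> + height Q (a, b)"
    unfolding A_def using apex_inner_le_height[OF Q(1,2)] r by blast
  also have "height Q (a, b) \<le> \<epsilon>"
    using height poly i B unfolding height_constant_def \<epsilon>_def by blast
  finally have "dist x q \<le> (1 + sqrt 2) * \<epsilon>" using dist by (simp add: algebra_simps)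
  moreover have "infdist x Q \<le> dist x q" using q by (rule infdist_le)
  ultimately show ?thesis by (simp add: \<epsilon>_def)
qed

section \<open>The constants\<close>

text \<open>The constant serves all polygons, so one example bounds it: the triangle has diameter at
  most \<open>sqrt 2\<close>, and its apex \<open>1 + \<i>\<close> is at distance
  \<open>1 / sqrt 2\<close> from the hypotenuse.\<close>

lemma height_constant_ge_half:
  assumes "height_constant \<alpha>"
  shows "1 / 2 \<le> \<alpha>"
proof -
  define T where "T = convex hull {0, 1, \<i>}"
  have poly: "convex_polygon T"
  proof -
    have "\<not> collinear {0, 1, \<i>}"
      by (auto simp: collinear_lemma complex_eq_iff)
    then have "aff_dim {0, 1, \<i>} > 1"
      by (simp add: collinear_aff_dim)
    moreover have "aff_dim {0, 1, \<i>} \<le> int DIM(complex)" by (rule aff_dim_le_DIM)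
    ultimately have "aff_dim {0, 1, \<i>} = 2" by simp
    then show ?thesis
      by (auto simp: convex_polygon_def T_def aff_dim_convex_hull intro: polytope_convex_hull)
  qed
  have Q: "compact T" "T \<noteq> {}"
    using poly by (auto simp: convex_polygon_def polytope_imp_compact)
  have half: "T \<subseteq> {x. (1 + \<i>) \<bullet> x \<le> 1}" "T \<subseteq> {x. (- 1) \<bullet> x \<le> 0}" "T \<subseteq> {x. (- \<i>) \<bullet> x \<le> 0}"
    unfolding T_def by (rule hull_minimal, simp add: inner_complex_def, rule convex_halfspace_le)+
  have T: "0 \<le> Re x" "0 \<le> Im x" "Re x + Im x \<le> 1" if "x \<in> T" for x
    using half that by (auto simp: inner_complex_def)
  have "diameter T \<le> sqrt 2"
  proof (rule diameter_le)
    fix x y assume "x \<in> T" "y \<in> T"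
    then have "\<bar>Re (x - y)\<bar> \<le> 1" "\<bar>Im (x - y)\<bar> \<le> 1" using T[of x] T[of y] by auto
    then have "(Re (x - y))\<^sup>2 \<le> 1" "(Im (x - y))\<^sup>2 \<le> 1" by (auto simp: abs_square_le_1)
    then show "norm (x - y) \<le> sqrt 2" unfolding cmod_def by (intro real_sqrt_le_mono) linarith
  qed auto
  have support_T: "support_value T 0 = 1" "support_value T (pi / 2) = 1"
  proof -
    have mem: "1 \<in> T" "\<i> \<in> T" by (auto simp: T_def hull_inc)
    have "Re x \<le> 1" "Im x \<le> 1" if "x \<in> T" for x using T[OF that] by linarith+
    then show "support_value T 0 = 1" "support_value T (pi / 2) = 1"
      using support_value_eqI[OF mem(1), of 0 1] support_value_eqI[OF mem(2), of "pi / 2" 1]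
      by (auto simp: inner_cis)
  qed
  define A where "A = apex T (0, pi / 2)"
  have "A \<bullet> cis 0 = 1" "A \<bullet> cis (pi / 2) = 1"
    unfolding A_def using apex_on_lines[of "pi / 2" 0 T] support_T by auto
  then have A: "Re A = 1" "Im A = 1" by (auto simp: inner_cis)
  have "1 / sqrt 2 \<le> height T (0, pi / 2)"
  proof -
    have "1 \<le> sqrt 2 * height T (0, pi / 2)"
    proof -
      obtain w where w: "w \<in> T" "support_value T (pi / 4) = w \<bullet> cis (pi / 4)"
        using support_value_attained[OF Q, of "pi / 4"] by metis
      have "support_value T (pi / 4) = (Re w + Im w) * (sqrt 2 / 2)"
        using w by (simp add: inner_cis sin_45 cos_45 algebra_simps)
      also have "\<dots> \<le> 1 * (sqrt 2 / 2)" using T[OF w(1)] by (intro mult_right_mono) auto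
      finally have "support_value T (pi / 4) \<le> sqrt 2 / 2" by simp
      moreover have "A \<bullet> cis (pi / 4) = sqrt 2" using A by (simp add: inner_cis sin_45 cos_45)
      ultimately have "sqrt 2 / 2 \<le> height T (0, pi / 2)"
        using apex_inner_le_height[OF Q, of 0 "pi / 2" "pi / 4"] by (simp add: A_def)
      from mult_left_mono[OF this, of "sqrt 2"] show ?thesis by simp
    qed
    then show ?thesis by (simp add: field_simps)
  qed
  also have "\<dots> \<le> \<alpha> * diameter T / 2 ^ 0"
    using assms poly unfolding height_constant_def by (metis compass_boomerangs.simps(1) insertI1 le0)
  finally have le: "1 / sqrt 2 \<le> \<alpha> * diameter T" by simp
  \<comment> \<open>The diameter is bounded only from above, so the sign of \<open>\<alpha>\<close>
    must be known before that bound applies.\<close>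
  have "diameter T \<ge> 0" using Q by (intro diameter_ge_0 compact_imp_bounded)
  moreover have "\<not> \<alpha> * diameter T \<le> 0" using le by (smt (verit) divide_pos_pos real_sqrt_gt_zero)
  ultimately have "\<alpha> \<ge> 0" by (meson linear mult_nonpos_nonneg)
  then have "1 / sqrt 2 \<le> \<alpha> * sqrt 2"
    using le mult_left_mono[OF \<open>diameter T \<le> sqrt 2\<close>, of \<alpha>] by linarith
  then show ?thesis by (simp add: field_simps)
qed

text \<open>A bounded set of dimension 2 is not affine, so its relative frontier is nonempty; it is
  the union of the facets, which are edges here.\<close>

lemma num_edges_pos:
  assumes "convex_polygon Q"
  shows "0 < num_edges Q"
proof -
  have Q: "polytope Q" "aff_dim Q = 2" using assms by (auto simp: convex_polygon_def)
  have "\<not> affine Q"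
    using affine_bounded_eq_trivial[of Q] Q polytope_imp_bounded[OF Q(1)] by auto
  then have "rel_frontier Q \<noteq> {}" by (simp add: rel_frontier_eq_empty)
  then obtain F where "F facet_of Q"
    using rel_frontier_of_polyhedron[OF polytope_imp_polyhedron[OF Q(1)]] by auto
  then have "F edge_of Q" using Q by (simp add: facet_of_def edge_of_def)
  moreover have "finite {F. F edge_of Q}"
    by (rule finite_subset[OF _ finite_polytope_faces[OF Q(1)]]) (auto simp: edge_of_def)
  ultimately show ?thesis unfolding num_edges_def by (auto simp: card_gt_0_iff)
qed

text \<open>At the last compass level the shift is thus at most \<open>\<alpha> * D / n\<close>,
  which the hypothesis on the distance can be compared with.\<close>

lemma num_edges_le_compass_depth: "real (num_edges Q) \<le> 2 ^ compass_depth Q"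
proof (cases "num_edges Q = 0")
  case False
  have "real (num_edges Q) = 2 powr log 2 (real (num_edges Q))" using False by simp
  also have "\<dots> \<le> 2 powr real (compass_depth Q)"
    unfolding compass_depth_def by (intro powr_mono real_nat_ceiling_ge) auto
  finally show ?thesis by (simp add: powr_realpow)
qed auto

lemma diameter_convex_polygon_pos:
  assumes "convex_polygon Q"
  shows "0 < diameter Q"
proof -
  have Q: "bounded Q" "aff_dim Q = 2"
    using assms by (auto simp: convex_polygon_def polytope_imp_bounded)
  have "\<exists>x\<in>Q. \<exists>y\<in>Q. x \<noteq> y"
  proof (rule ccontr)
    assume "\<not> ?thesis"
    then obtain x where "Q \<subseteq> {x}" by blast
    then have "aff_dim Q \<le> aff_dim {x}" by (rule aff_dim_subset)
    with Q show False by simp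
  qed
  then obtain x y where "x \<in> Q" "y \<in> Q" "x \<noteq> y" by blast
  then show ?thesis
    using diameter_bounded_bound[OF Q(1), of x y] by (smt (verit) zero_less_dist_iff)
qed

text \<open>Level 0 bounds \<open>y - z\<close> in the four compass directions, hence in both
  coordinates; the diagonal of a square gives \<open>sqrt 2\<close>.\<close>

lemma dist_inflated_zero_le:
  assumes Q: "compact Q" and y: "y \<in> inflated \<alpha> Q 0" and z: "z \<in> Q"
  shows "dist y z \<le> sqrt 2 * (diameter Q + \<alpha> * diameter Q)"
proof -
  have ne: "Q \<noteq> {}" using z by blast
  define R where "R = diameter Q + \<alpha> * diameter Q"
  have bound: "(y - z) \<bullet> cis \<theta> \<le> R" if "\<theta> \<in> {0, pi / 2, pi, 3 * pi / 2}" for \<theta>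
  proof -
    obtain w where w: "w \<in> Q" "support_value Q \<theta> = w \<bullet> cis \<theta>"
      using support_value_attained[OF Q ne, of \<theta>] by metis
    have "y \<bullet> cis \<theta> \<le> support_value Q \<theta> + \<alpha> * diameter Q"
      using y that unfolding inflated_iff[OF Q ne]
      by (elim ballE[of _ _ \<theta>]) (auto simp: envelope_angles_def)
    moreover have "(w - z) \<bullet> cis \<theta> \<le> norm (w - z)"
      using norm_cauchy_schwarz[of "w - z" "cis \<theta>"] by simp
    moreover have "norm (w - z) \<le> diameter Q"
      using diameter_bounded_bound[OF compact_imp_bounded[OF Q] w(1) z] by (simp add: dist_norm)
    ultimately show ?thesis using w by (simp add: R_def inner_diff_left)
  qed
  have trig: "cos (3 * pi / 2) = 0" "sin (3 * pi / 2) = - 1"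
    using cos_3over2_pi sin_3over2_pi by (simp_all add: field_simps)
  have "\<bar>Re (y - z)\<bar> \<le> R" "\<bar>Im (y - z)\<bar> \<le> R"
    using bound[of 0] bound[of "pi / 2"] bound[of pi] bound[of "3 * pi / 2"]
    by (auto simp: inner_cis trig)
  then have "(Re (y - z))\<^sup>2 \<le> R\<^sup>2" "(Im (y - z))\<^sup>2 \<le> R\<^sup>2" and "R \<ge> 0"
    by (auto simp: abs_le_square_iff[symmetric])
  then have "dist y z \<le> sqrt (2 * R\<^sup>2)"
    unfolding dist_norm cmod_def by (intro real_sqrt_le_mono) linarith
  then show ?thesis using \<open>R \<ge> 0\<close> by (simp add: real_sqrt_mult R_def)
qed

section \<open>Events\<close>

lemma reselect_ray:
  assumes poly: "convex_polygon Q" and \<alpha>: "0 < \<alpha>"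
    and \<theta>: "\<theta> \<in> envelope_angles Q i" and x: "x \<in> support_line (envelope Q i) \<theta>"
    and reselect: "reselect \<alpha> Q i \<theta> x j \<theta>'"
  obtains s y z where "1 \<le> s" "z \<in> Q" "y \<in> inflated \<alpha> Q j" "dist x z = s * dist y z"
    "support_value (envelope Q j) \<theta>' + s * (\<alpha> * diameter Q / 2 ^ j) \<le> x \<bullet> cis \<theta>'"
proof -
  have Q: "compact Q" "Q \<noteq> {}"
    using poly by (auto simp: convex_polygon_def polytope_imp_compact)
  define \<epsilon> h where "\<epsilon> = \<alpha> * diameter Q / 2 ^ j" and "h = support_value Q \<theta>'"
  have pos: "0 < \<alpha> * diameter Q" using \<alpha> diameter_convex_polygon_pos[OF poly] by simp
  then have \<epsilon>: "0 < \<epsilon>" by (simp add: \<epsilon>_def)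
  have sep: "x \<notin> inflated \<alpha> Q j" "\<theta>' \<in> envelope_angles Q j"
    and sep': "support_value (envelope Q j) \<theta>' < x \<bullet> cis \<theta>'"
    and meet: "edge (inflated \<alpha> Q j) \<theta>' \<inter> support_line (envelope Q i) \<theta> \<noteq> {}"
    using reselect by (auto simp: reselect_def separating_def)
  note env = support_value_envelope[OF Q \<theta>] support_value_envelope[OF Q sep(2), folded h_def]
  obtain y where y: "y \<in> inflated \<alpha> Q j" "y \<bullet> cis \<theta>' = h + \<epsilon>" "y \<bullet> cis \<theta> = support_value Q \<theta>"
    using meet support_value_inflated[OF Q less_imp_le[OF pos] sep(2)] env
    unfolding edge_def support_line_def \<epsilon>_def h_def by fastforce
  obtain z where z: "z \<in> Q" "support_value Q \<theta> = z \<bullet> cis \<theta>"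
    using support_value_attained[OF Q, of \<theta>] by metis
  have zh: "z \<bullet> cis \<theta>' \<le> h" unfolding h_def using z(1) by (rule inner_le_support_value[OF Q(1)])
  have xline: "x \<bullet> cis \<theta> = z \<bullet> cis \<theta>" using x z env by (simp add: support_line_def)
  \<comment> \<open>The position of \<open>x\<close> on the line from \<open>z\<close> through
    \<open>y\<close>, read off in direction \<open>cis \<theta>'\<close>.\<close>
  define s where "s = (x \<bullet> cis \<theta>' - z \<bullet> cis \<theta>') / (y \<bullet> cis \<theta>' - z \<bullet> cis \<theta>')"
  have den: "y \<bullet> cis \<theta>' - z \<bullet> cis \<theta>' > 0" using y zh \<epsilon> by simp
  \<comment> \<open>If the normals were parallel, \<open>y - z\<close>, orthogonal to
    \<open>cis \<theta>\<close>, would be orthogonal to \<open>cis \<theta>'\<close> too, contrary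
    to \<open>den\<close>.\<close>
  have "sin (\<theta>' - \<theta>) \<noteq> 0"
  proof
    assume s0: "sin (\<theta>' - \<theta>) = 0"
    have "(y - z) \<bullet> cis \<theta>' = cos (\<theta>' - \<theta>) * ((y - z) \<bullet> cis \<theta>)
        + sin (\<theta>' - \<theta>) * (Im (y - z) * cos \<theta> - Re (y - z) * sin \<theta>)"
    proof -
      have "cis \<theta>' = cis ((\<theta>' - \<theta>) + \<theta>)" by simp
      then show ?thesis
        by (simp only: inner_cis cis.simps cos_add sin_add)
          (simp add: inner_cis cos_add sin_add algebra_simps)
    qed
    with s0 y z den show False by (simp add: inner_diff_left)
  qed
  then have line: "u = 0" if "u \<bullet> cis \<theta> = 0" "u \<bullet> cis \<theta>' = 0" for u
  proof -
    have "u \<bullet> cis \<phi> = 0" for \<phi>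
      using inner_sin_diff_cis[of \<theta>' \<theta> u \<phi>] that \<open>sin (\<theta>' - \<theta>) \<noteq> 0\<close> by simp
    from this[of 0] this[of "pi/2"] show ?thesis by (simp add: inner_cis complex_eq_iff)
  qed
  have "x - z - s *\<^sub>R (y - z) = 0"
    by (rule line) (use xline y z den in \<open>auto simp: inner_diff_left s_def\<close>)
  then have xs: "x = (1 - s) *\<^sub>R z + s *\<^sub>R y" by (simp add: algebra_simps)
  \<comment> \<open>The new edge separates \<open>x\<close> from \<open>Q\<close>, which puts
    \<open>x\<close> on the same side of \<open>z\<close> as \<open>y\<close>.\<close>
  have "0 \<le> s" unfolding s_def using den sep' zh env by (intro divide_nonneg_pos) auto
  \<comment> \<open>Between \<open>z\<close> and \<open>y\<close> the point \<open>x\<close> would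
    belong to the convex set \<open>Q'\<^sub>j\<close>.\<close>
  have "1 \<le> s"
  proof (rule ccontr)
    assume "\<not> 1 \<le> s"
    moreover have "z \<in> inflated \<alpha> Q j" using subset_inflated[OF Q(1) less_imp_le[OF pos]] z(1) by blast
    ultimately have "x \<in> inflated \<alpha> Q j"
      unfolding xs using \<open>0 \<le> s\<close> y convex_inflated by (intro convexD) auto
    with sep show False by blast
  qed
  \<comment> \<open>From \<open>z\<close> to \<open>y\<close> the height rises by at least
    \<open>\<epsilon>\<close>, so going on past \<open>y\<close> gains at least that rate.\<close>
  have "x \<bullet> cis \<theta>' - h - s * \<epsilon> = (s - 1) * (h - z \<bullet> cis \<theta>')"
    unfolding xs using y(2) by (simp add: inner_add_left algebra_simps)
  moreover have "(s - 1) * (h - z \<bullet> cis \<theta>') \<ge> 0" using \<open>1 \<le> s\<close> zh by simp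
  ultimately have "h + s * \<epsilon> \<le> x \<bullet> cis \<theta>'" by simp
  moreover have "dist x z = s * dist y z"
  proof -
    have "x - z = s *\<^sub>R (y - z)" unfolding xs by (simp add: algebra_simps)
    then show ?thesis using \<open>0 \<le> s\<close> by (simp add: dist_norm)
  qed
  ultimately show thesis using that[OF \<open>1 \<le> s\<close> z(1) y(1)] env by (simp add: \<epsilon>_def)
qed

lemma maintains_angle:
  assumes "maintains \<alpha> Q p s i \<theta>"
  shows "\<theta> \<in> envelope_angles Q i"
  using assms by cases (auto simp: separating_def reselect_def)

text \<open>The right side is the distance from \<open>x\<close> to the line that the point has to
  reach for the next event.\<close>

lemma reselect_distance:
  assumes height: "height_constant \<alpha>" and poly: "convex_polygon Q"
    and \<theta>: "\<theta> \<in> envelope_angles Q i" and x: "x \<in> support_line (envelope Q i) \<theta>"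
    and reselect: "reselect \<alpha> Q i \<theta> x j \<theta>'"
    and far: "((1 + sqrt 2) * \<alpha> + 1) * diameter Q / real (num_edges Q) \<le> infdist x Q"
  shows "infdist x Q / (2 * (1 + sqrt 2)) \<le> x \<bullet> cis \<theta>' - support_value (envelope Q j) \<theta>'"
proof -
  define D \<epsilon> where "D = diameter Q" and "\<epsilon> = \<alpha> * D / 2 ^ j"
  have Q: "compact Q" "Q \<noteq> {}"
    using poly by (auto simp: convex_polygon_def polytope_imp_compact)
  have \<alpha>: "1 / 2 \<le> \<alpha>" using height by (rule height_constant_ge_half)
  have D: "0 < D" unfolding D_def using poly by (rule diameter_convex_polygon_pos)
  have pos: "0 < \<alpha> * D" using \<alpha> D by simp
  then have \<epsilon>: "0 < \<epsilon>" by (simp add: \<epsilon>_def)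
  obtain s y z where s: "1 \<le> s" and z: "z \<in> Q" and y: "y \<in> inflated \<alpha> Q j"
    and xz: "dist x z = s * dist y z"
    and gap: "support_value (envelope Q j) \<theta>' + s * \<epsilon> \<le> x \<bullet> cis \<theta>'"
    using reselect_ray[OF poly _ \<theta> x reselect] \<alpha> unfolding \<epsilon>_def D_def
    by (metis less_le_trans half_gt_zero zero_less_one)
  have "infdist x Q \<le> 2 * (1 + sqrt 2) * (s * \<epsilon>)"
  proof (cases j)
    case 0
    have "D \<le> 2 * \<epsilon>" using mult_right_mono[OF \<alpha>, of D] D 0 by (simp add: \<epsilon>_def)
    have "infdist x Q \<le> s * dist y z" using infdist_le[OF z, of x] xz by simp
    also have "dist y z \<le> sqrt 2 * (D + \<epsilon>)"
      using dist_inflated_zero_le[OF Q(1) _ z] y 0 by (simp add: D_def \<epsilon>_def)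
    also have "\<dots> \<le> sqrt 2 * (3 * \<epsilon>)" using \<open>D \<le> 2 * \<epsilon>\<close> by (intro mult_left_mono) auto
    also have "\<dots> \<le> 2 * (1 + sqrt 2) * \<epsilon>"
    proof -
      \<comment> \<open>This is \<open>3 * sqrt 2 \<le> 2 * (1 + sqrt 2)\<close> rearranged.\<close>
      have "sqrt 2 \<le> 2" by (rule real_le_lsqrt) auto
      then have "(3 * sqrt 2) * \<epsilon> \<le> (2 * (1 + sqrt 2)) * \<epsilon>" using \<epsilon> by (intro mult_right_mono) auto
      then show ?thesis by (simp add: algebra_simps)
    qed
    finally show ?thesis using s by (simp add: mult.left_commute mult_left_mono)
  next
    case (Suc k)
    have xk: "x \<in> inflated \<alpha> Q k" using reselect Suc by (simp add: reselect_def)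
    \<comment> \<open>At a deeper level \<open>x\<close> would also lie in the inflated envelope of
      the last compass level, too close to \<open>Q\<close> for \<open>far\<close>.\<close>
    have "k \<le> compass_depth Q"
    proof (rule ccontr)
      define d n where "d = compass_depth Q" and "n = real (num_edges Q)"
      assume "\<not> k \<le> compass_depth Q"
      then have "x \<in> inflated \<alpha> Q d"
        using xk inflated_antimono[OF Q, of \<alpha> d k] pos by (auto simp: d_def D_def)
      then have "infdist x Q \<le> (1 + sqrt 2) * (\<alpha> * D / 2 ^ d)"
        unfolding D_def d_def using pos
        by (intro infdist_inflated_le[OF height poly]) (auto simp: D_def)
      also have "\<dots> \<le> (1 + sqrt 2) * (\<alpha> * D / n)"
        using num_edges_le_compass_depth[of Q] num_edges_pos[OF poly] pos
        by (intro mult_left_mono divide_left_mono) (auto simp: n_def d_def)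
      \<comment> \<open>The summand 1 in the constant makes this strict.\<close>
      also have "\<dots> < ((1 + sqrt 2) * \<alpha> + 1) * D / n"
        using num_edges_pos[OF poly] D by (simp add: n_def divide_strict_right_mono algebra_simps)
      finally show False using far by (simp add: D_def n_def)
    qed
    then have "infdist x Q \<le> (1 + sqrt 2) * (\<alpha> * D / 2 ^ k)"
      unfolding D_def using pos xk by (intro infdist_inflated_le[OF height poly]) (auto simp: D_def)
    \<comment> \<open>The shift at level \<open>k = j - 1\<close> is twice that at level
      \<open>j\<close>: the factor 2 in the final constant.\<close>
    also have "\<dots> = 2 * (1 + sqrt 2) * \<epsilon>" by (simp add: \<epsilon>_def Suc field_simps)
    also have "\<dots> \<le> 2 * (1 + sqrt 2) * (s * \<epsilon>)"
      using s \<epsilon> by (intro mult_left_mono) (auto simp: mult_le_cancel_right1)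
    finally show ?thesis .
  qed
  moreover have "0 < 2 * (1 + sqrt 2)" by (simp add: add_pos_nonneg)
  ultimately have "infdist x Q / (2 * (1 + sqrt 2)) \<le> s * \<epsilon>"
    by (simp add: pos_divide_le_eq mult.commute)
  with gap show ?thesis by linarith
qed

theorem lemma6p1:
  fixes \<alpha> :: real
  assumes "height_constant \<alpha>"
  shows "\<exists>c>0. \<forall>(Q :: complex set) (p :: real \<Rightarrow> complex) (n :: nat) (D :: real)
            s i \<theta> t j \<theta>' t'.
           convex_polygon Q \<longrightarrow> n = num_edges Q \<longrightarrow> D = diameter Q \<longrightarrow>
           continuous_on {0..} p \<longrightarrow>
           maintains \<alpha> Q p s i \<theta> \<longrightarrow>
           next_event Q p i \<theta> s t \<longrightarrow> reselect \<alpha> Q i \<theta> (p t) j \<theta>' \<longrightarrow>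
           infdist (p t) Q \<ge> c * D / real n \<longrightarrow>
           next_event Q p j \<theta>' t t' \<longrightarrow>
           dist (p t) (p t') \<ge> infdist (p t) Q / (2 * (1 + sqrt 2))"
proof (intro exI[of _ "(1 + sqrt 2) * \<alpha> + 1"] conjI allI impI)
  show "0 < (1 + sqrt 2) * \<alpha> + 1"
    using height_constant_ge_half[OF assms] by (intro add_nonneg_pos mult_nonneg_nonneg) auto
next
  fix Q :: "complex set" and p :: "real \<Rightarrow> complex" and n :: nat and D :: real
    and s i \<theta> t j \<theta>' t'
  assume poly: "convex_polygon Q" and n: "n = num_edges Q" and D: "D = diameter Q"
    and maintains: "maintains \<alpha> Q p s i \<theta>" and event: "next_event Q p i \<theta> s t"
    and reselect: "reselect \<alpha> Q i \<theta> (p t) j \<theta>'"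
    and far: "infdist (p t) Q \<ge> ((1 + sqrt 2) * \<alpha> + 1) * D / real n"
    and event': "next_event Q p j \<theta>' t t'"
  have "infdist (p t) Q / (2 * (1 + sqrt 2)) \<le> p t \<bullet> cis \<theta>' - support_value (envelope Q j) \<theta>'"
    using reselect_distance[OF assms poly maintains_angle[OF maintains] _ reselect] event far n D
    by (simp add: next_event_def)
  \<comment> \<open>At \<open>t'\<close> the point is on the line of the new edge, so its
    displacement has the whole gap as normal component.\<close>
  also have "\<dots> = (p t - p t') \<bullet> cis \<theta>'"
    using event' by (simp add: next_event_def support_line_def inner_diff_left)
  also have "\<dots> \<le> dist (p t) (p t')"
    using norm_cauchy_schwarz[of "p t - p t'" "cis \<theta>'"] by (simp add: dist_norm)
  finally show "dist (p t) (p t') \<ge> infdist (p t) Q / (2 * (1 + sqrt 2))" .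
qed

end
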